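(* Let $q$ be a prime power, or more generally any complex number with $|q|>1$. Then the following limits exist and are given by $$g_{2\infty +1}(q) := \lim_{n \rightarrow \infty} G_{2n+1}(q) \cdot q^{-\frac{(2n+1)^2 }{4}} = \frac{\vartheta_2(0,q^{-1})}{\phi(q^{-1})},$$ $$g_{2\infty}(q) := \lim_{n \rightarrow \infty} G_{2n}(q) \cdot q^{- \frac{(2n)^2}{4}} = \frac{\vartheta_3(0,q^{-1})}{\phi(q^{-1})},$$ and they differ by $$g_{2\infty}(q) - g_{2\infty +1}(q) = \frac{\vartheta_4(0,q^{-\frac 14})}{\phi(q^{-1})} .$$ Here $\phi(x) = \prod_{m=1}^\infty (1-x^{m})$ and $\vartheta_2,\vartheta_3,\vartheta_4$ are the Jacobi theta functions $$\vartheta_2(z,q) = \sum_{k=-\infty}^{\infty} q^{(k+ \frac 12)^2} e^{(2k+1)iz},\quad \vartheta_3(z,q) = \sum_{k=-\infty}^{\infty} q^{k^2} e^{2kiz},\quad \vartheta_4(z,q) = \sum_{k=-\infty}^\infty (-1)^k q^{k^2}e^{2kiz} .$$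
   Context: The classical Galois number $G_N(q)$ is the polynomial $G_N(q)=\sum_{k=0}^N \begin{bmatrix} N\\k\end{bmatrix}_q$, where $\begin{bmatrix} N\\k\end{bmatrix}_q$ is the Gaussian ($q$-)binomial coefficient; for a prime power $q$ it is the total number of subspaces of $\mathbf{F}_q^N$. For complex $q$, $G_N(q)$ is the value of this polynomial. Fractional powers: for real $q>1$ they are the positive real ones; for complex $q$ one fixes a fourth root $q^{1/4}$ and sets $q^{a/4}=(q^{1/4})^a$ for all integers $a$, using the same choice throughout (including $(q^{-1})^{(k+1/2)^2}=q^{-(2k+1)^2/4}$ in $\vartheta_2(0,q^{-1})$). *)

theory Defs
  imports "HOL-Analysis.Analysis" "HOL-Computational_Algebra.Polynomial"
begin

section \<open>Gaussian binomial coefficients and Galois numbers\<close>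

text \<open>
  As a polynomial in \<open>X\<close>, the Gaussian binomial coefficient is the quotient
  \<open>\<Prod>\<^sub>i\<^sub><\<^sub>k (X^(N-i) - 1) / \<Prod>\<^sub>i\<^sub><\<^sub>k (X^(i+1) - 1)\<close>. The division is exact, see
  \<open>gauss_binomial_mult\<close> below. For \<open>k > N\<close> the factor with \<open>i = N\<close> makes it vanish.
\<close>
definition gauss_binomial :: "nat \<Rightarrow> nat \<Rightarrow> 'a::idom_divide poly" where
  "gauss_binomial N k =
     (\<Prod>i<k. monom 1 (N - i) - 1) div (\<Prod>i<k. monom 1 (i + 1) - 1)"

definition galois_poly :: "nat \<Rightarrow> 'a::idom_divide poly" where
  "galois_poly N = (\<Sum>k\<le>N. gauss_binomial N k)"

definition galois_number :: "nat \<Rightarrow> complex \<Rightarrow> complex" where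
  "galois_number N q = poly (galois_poly N) q"

lemma gauss_binomial_dvd:
  "(\<Prod>i<k. monom 1 (i + 1) - 1) dvd (\<Prod>i<k. monom (1::'a::comm_ring_1) (N - i) - 1)"
proof (induction N arbitrary: k)
  case 0
  show ?case
    by (cases k) (simp_all add: prod.lessThan_Suc_shift one_pCons monom_0 del: prod.lessThan_Suc)
next
  case (Suc N)
  show ?case
  proof (cases k)
    case 0
    then show ?thesis by simp
  next
    case k: (Suc j)
    let ?num = "\<lambda>N k. \<Prod>i<k. monom (1::'a) (N - i) - 1"
    let ?den = "\<lambda>k. \<Prod>i<k. monom (1::'a) (i + 1) - 1"
    have step: "?num (Suc N) (Suc j) = (monom 1 (Suc N) - 1) * ?num N j"
      by (simp add: prod.lessThan_Suc_shift del: prod.lessThan_Suc)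
    show ?thesis
    proof (cases "j \<le> N")
      case True
      have "monom (1::'a) (Suc N) = monom 1 (Suc j) * monom 1 (N - j)"
        using True by (simp add: mult_monom)
      hence eq: "?num (Suc N) (Suc j) =
          (monom 1 (Suc j) - 1) * ?num N j + monom 1 (Suc j) * ?num N (Suc j)"
        unfolding step by (simp add: algebra_simps)
      have "?den (Suc j) dvd (monom 1 (Suc j) - 1) * ?num N j"
        using mult_dvd_mono[OF dvd_refl[of "monom (1::'a) (Suc j) - 1"] Suc.IH[of j]]
        by (simp add: mult.commute)
      moreover have "?den (Suc j) dvd monom 1 (Suc j) * ?num N (Suc j)"
        by (rule dvd_mult[OF Suc.IH])
      ultimately show ?thesis
        unfolding k eq by (rule dvd_add)
    next
      case False
      have "?num N j = 0"
        by (rule prod_zero) (use False in \<open>auto intro!: bexI[of _ N] simp: one_pCons monom_0\<close>)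
      then show ?thesis
        unfolding k step by simp
    qed
  qed
qed

lemma gauss_binomial_mult:
  "gauss_binomial N k * (\<Prod>i<k. monom (1::'a::idom_divide) (i + 1) - 1)
     = (\<Prod>i<k. monom 1 (N - i) - 1)"
  unfolding gauss_binomial_def by (rule dvd_div_mult_self[OF gauss_binomial_dvd])

section \<open>The product \<open>\<phi>\<close> and the Jacobi theta functions\<close>

definition phi :: "complex \<Rightarrow> complex" where
  "phi x = (\<Prod>m. 1 - x ^ (m + 1))"

text \<open>
  The terms of \<open>\<vartheta>\<^sub>2\<close> involve the powers \<open>x^((k+1/2)^2) = x^((2k+1)^2/4)\<close> of the nome \<open>x\<close>, so
  \<open>\<vartheta>\<^sub>2\<close> depends on a choice of fourth root of \<open>x\<close>. The second argument of
  \<open>theta2\<close> is this fourth root: \<open>theta2 z s\<close> is \<open>\<vartheta>\<^sub>2(z, s^4)\<close> with \<open>(s^4)^(a/4) = s^a\<close>.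
  The second argument of \<open>theta3\<close> and \<open>theta4\<close> is the nome itself.
\<close>
definition theta2 :: "complex \<Rightarrow> complex \<Rightarrow> complex" where
  "theta2 z s = (\<Sum>\<^sub>\<infinity>k::int. s powi ((2 * k + 1)\<^sup>2) * exp (of_int (2 * k + 1) * \<i> * z))"

definition theta3 :: "complex \<Rightarrow> complex \<Rightarrow> complex" where
  "theta3 z x = (\<Sum>\<^sub>\<infinity>k::int. x powi (k\<^sup>2) * exp (2 * of_int k * \<i> * z))"

definition theta4 :: "complex \<Rightarrow> complex \<Rightarrow> complex" where
  "theta4 z x = (\<Sum>\<^sub>\<infinity>k::int. (-1) powi k * x powi (k\<^sup>2) * exp (2 * of_int k * \<i> * z))"

lemma phi_has_prod:
  assumes "norm x < 1"
  shows "(\<lambda>m. 1 - x ^ (m + 1)) has_prod phi x"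
proof -
  have "summable (\<lambda>m. norm (x ^ (m + 1)))"
    using assms by (simp add: norm_mult norm_power summable_mult summable_geometric)
  hence "abs_convergent_prod (\<lambda>m. 1 - x ^ (m + 1))"
    by (simp add: abs_convergent_prod_conv_summable)
  thus ?thesis
    unfolding phi_def by (intro convergent_prod_has_prod abs_convergent_prod_imp_convergent_prod)
qed

lemma theta_terms_summable:
  fixes t c :: complex
  assumes t: "norm t < 1" and c: "c \<noteq> 0"
  shows "(\<lambda>k::int. t powi (k\<^sup>2) * c powi k) summable_on UNIV"
proof -
  have nat: "(\<lambda>n. t ^ (n\<^sup>2) * b ^ n) summable_on (UNIV :: nat set)" for b :: complex
  proof -
    have "(\<lambda>n. norm t ^ n * norm b) \<longlonglongrightarrow> 0 * norm b"
      using t by (intro tendsto_mult LIMSEQ_realpow_zero) auto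
    hence "eventually (\<lambda>n. norm t ^ n * norm b < 1 / 2) sequentially"
      by (intro order_tendstoD) auto
    hence "eventually (\<lambda>n. norm (norm (t ^ (n\<^sup>2) * b ^ n)) \<le> (1 / 2) ^ n) sequentially"
    proof eventually_elim
      case (elim n)
      have "norm (t ^ (n\<^sup>2) * b ^ n) = (norm t ^ n * norm b) ^ n"
        by (simp add: norm_mult norm_power power_mult_distrib power2_eq_square flip: power_mult)
      also have "\<dots> \<le> (1 / 2) ^ n"
        using elim by (intro power_mono) auto
      finally show ?case by simp
    qed
    hence "summable (\<lambda>n. norm (t ^ (n\<^sup>2) * b ^ n))"
      by (rule summable_comparison_test_ev) (simp add: summable_geometric)
    thus ?thesis
      by (rule norm_summable_imp_summable_on)
  qed
  let ?f = "\<lambda>k::int. t powi (k\<^sup>2) * c powi k"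
  have sq: "t powi ((int n)\<^sup>2) = t ^ (n\<^sup>2)" for n
    by (metis of_nat_power power_int_of_nat)
  have "?f \<circ> int = (\<lambda>n. t ^ (n\<^sup>2) * c ^ n)"
    by (simp add: fun_eq_iff sq)
  moreover have "?f \<circ> (\<lambda>n. - int n) = (\<lambda>n. t ^ (n\<^sup>2) * inverse c ^ n)"
    by (simp add: fun_eq_iff sq power_int_minus power_inverse)
  ultimately have "?f summable_on range int" "?f summable_on range (\<lambda>n. - int n)"
    using nat by (simp_all add: summable_on_reindex inj_def)
  hence "?f summable_on (range int \<union> range (\<lambda>n. - int n))"
    by (rule summable_on_union)
  moreover have "range int \<union> range (\<lambda>n. - int n) = UNIV"
    by (metis (no_types, lifting) UNIV_eq_I UnI1 UnI2 int_cases2 range_eqI)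
  ultimately show ?thesis by simp
qed

lemma exp_mult_int: "exp (of_int k * w) = exp w powi k" for w :: complex
  by (cases k rule: int_cases2) (simp_all add: exp_of_nat_mult exp_minus power_int_minus)

lemma theta2_summable:
  assumes "norm s < 1"
  shows "(\<lambda>k::int. s powi ((2 * k + 1)\<^sup>2) * exp (of_int (2 * k + 1) * \<i> * z)) summable_on UNIV"
proof -
  let ?f = "\<lambda>k::int. s powi (k\<^sup>2) * exp (\<i> * z) powi k" and ?h = "\<lambda>k::int. 2 * k + 1"
  have "?f summable_on range ?h"
    by (rule summable_on_subset_banach[OF theta_terms_summable]) (use assms in auto)
  hence "(?f \<circ> ?h) summable_on UNIV"
    by (subst (asm) summable_on_reindex) (auto simp: inj_def)
  moreover have "(?f \<circ> ?h) =
      (\<lambda>k. s powi ((2 * k + 1)\<^sup>2) * exp (of_int (2 * k + 1) * \<i> * z))"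
    by (simp only: fun_eq_iff o_def mult.assoc exp_mult_int simp_thms)
  ultimately show ?thesis by simp
qed

lemma theta3_summable:
  assumes "norm x < 1"
  shows "(\<lambda>k::int. x powi (k\<^sup>2) * exp (2 * of_int k * \<i> * z)) summable_on UNIV"
proof -
  have "exp (2 * of_int k * \<i> * z) = exp (2 * \<i> * z) powi k" for k
    using exp_mult_int[of k "2 * \<i> * z"] by (simp add: mult_ac)
  thus ?thesis
    using theta_terms_summable[OF assms, of "exp (2 * \<i> * z)"] by simp
qed

lemma theta4_summable:
  assumes "norm x < 1"
  shows "(\<lambda>k::int. (-1) powi k * x powi (k\<^sup>2) * exp (2 * of_int k * \<i> * z)) summable_on UNIV"
proof -
  have eq: "(-1) powi k * x powi (k\<^sup>2) * exp (2 * of_int k * \<i> * z)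
      = x powi (k\<^sup>2) * ((-1) * exp (2 * \<i> * z)) powi k" for k
    unfolding power_int_mult_distrib using exp_mult_int[of k "2 * \<i> * z"]
    by (simp add: mult_ac)
  show ?thesis
    unfolding eq using theta_terms_summable[OF assms, of "(-1) * exp (2 * \<i> * z)"]
    by (metis exp_not_eq_zero mult_eq_0_iff neg_equal_0_iff_equal zero_neq_one)
qed

section \<open>Limits of normalized Galois numbers\<close>

text \<open>
  Here \<open>r\<close> is the chosen fourth root \<open>q^(1/4)\<close>, so that \<open>q^(-N^2/4)\<close> is \<open>r powi (-N^2)\<close>.
\<close>
definition galois_limit_odd :: "complex \<Rightarrow> complex \<Rightarrow> complex" where
  "galois_limit_odd q r =
     lim (\<lambda>n. galois_number (2 * n + 1) q * r powi (- ((2 * int n + 1)\<^sup>2)))"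

definition galois_limit_even :: "complex \<Rightarrow> complex \<Rightarrow> complex" where
  "galois_limit_even q r =
     lim (\<lambda>n. galois_number (2 * n) q * r powi (- ((2 * int n)\<^sup>2)))"

end

theory Submission
  imports Defs
begin

text \<open>
  Write \<open>p = 1/q\<close>, \<open>s = 1/r\<close> and \<open>P\<^sub>n = (1 - p) \<cdots> (1 - p^n)\<close>. Rewriting the Gaussian binomial
  coefficient in terms of \<open>p\<close> gives \<open>q^(k(N-k)) P\<^sub>N / (P\<^sub>k P\<^bsub>N-k\<^esub>)\<close>, and \<open>4k(N-k) - N^2 = -(N-2k)^2\<close>,
  so the normalized Galois number is the sum of \<open>s^((N-2k)^2) P\<^sub>N / (P\<^sub>k P\<^bsub>N-k\<^esub>)\<close> over \<open>k \<le> N\<close>.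
  Centering the index at \<open>N/2\<close>, every quotient tends to \<open>1 / \<phi>(p)\<close> and all of them are uniformly
  bounded, so the limit follows by dominated convergence. The two limits collect the terms
  \<open>s^(m^2)\<close> with \<open>m\<close> odd and \<open>m\<close> even, hence their difference is the alternating sum \<open>\<vartheta>\<^sub>4\<close>.
\<close>

section \<open>Dominated convergence for infinite sums\<close>

lemma infsum_dominated_convergence:
  fixes f :: "nat \<Rightarrow> 'a \<Rightarrow> 'b::{banach, second_countable_topology}"
  assumes h: "h summable_on A"
    and le: "\<And>n x. x \<in> A \<Longrightarrow> norm (f n x) \<le> h x"
    and lim: "\<And>x. x \<in> A \<Longrightarrow> (\<lambda>n. f n x) \<longlonglongrightarrow> g x"
  shows "(\<lambda>n. infsum (f n) A) \<longlonglongrightarrow> infsum g A"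
proof -
  have h_nonneg: "0 \<le> h x" if "x \<in> A" for x
    using le[OF that, of 0] norm_ge_zero order_trans by blast
  have "(\<lambda>x. norm (h x)) summable_on A"
    using h h_nonneg by (simp cong: summable_on_cong)
  hence h_abs: "Infinite_Set_Sum.abs_summable_on h A"
    by (subst abs_summable_equivalent[symmetric]) simp
  have g_le: "norm (g x) \<le> h x" if "x \<in> A" for x
    using lim[OF that] le[OF that] by (intro LIMSEQ_le_const2[OF tendsto_norm]) auto
  have f_abs: "Infinite_Set_Sum.abs_summable_on (f n) A" for n
    by (rule abs_summable_on_comparison_test[OF h_abs]) (simp add: h_nonneg le)
  have g_abs: "Infinite_Set_Sum.abs_summable_on g A"
    by (rule abs_summable_on_comparison_test[OF h_abs]) (simp add: h_nonneg g_le)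
  \<comment> \<open>An \<open>infsetsum\<close> is an integral against the counting measure, where
    Lebesgue's theorem applies. Absolute summability carries the result over to
    \<open>infsum\<close>.\<close>
  have "(\<lambda>n. infsetsum (f n) A) \<longlonglongrightarrow> infsetsum g A"
    using h_abs unfolding infsetsum_def abs_summable_on_def
    by (intro integral_dominated_convergence[where w = h])
      (auto simp: AE_count_space le lim)
  thus ?thesis
    by (simp add: infsetsum_infsum f_abs g_abs)
qed

section \<open>The finite products \<open>(x; x)_n\<close> and their limit\<close>

definition phi_partial :: "complex \<Rightarrow> nat \<Rightarrow> complex" where
  "phi_partial x n = (\<Prod>i<n. 1 - x ^ (i + 1))"

lemma phi_factor_nonzero:
  fixes x :: complex
  assumes "norm x < 1"
  shows "1 - x ^ (m + 1) \<noteq> 0"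
proof
  assume "1 - x ^ (m + 1) = 0"
  hence "norm x ^ (m + 1) = 1"
    by (metis eq_iff_diff_eq_0 norm_one norm_power)
  thus False
    using power_less_one_iff[of "norm x" "m + 1"] assms by auto
qed

lemma phi_partial_nonzero: "norm x < 1 \<Longrightarrow> phi_partial x n \<noteq> 0"
  using phi_factor_nonzero by (simp add: phi_partial_def)

lemma phi_nonzero:
  assumes "norm x < 1"
  shows "phi x \<noteq> 0"
  using has_prod_eq_0_iff[OF phi_has_prod[OF assms]] phi_factor_nonzero[OF assms] by auto

lemma phi_partial_tendsto: "norm x < 1 \<Longrightarrow> phi_partial x \<longlonglongrightarrow> phi x"
  unfolding phi_partial_def
  using has_prod_imp_tendsto'[OF phi_has_prod] by blast

section \<open>Gaussian binomials at \<open>q\<close> through products in \<open>1/q\<close>\<close>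

lemma power_minus_one_mult_phi_partial:
  assumes "q \<noteq> 0"
  shows "(q ^ Suc m - 1) * phi_partial (inverse q) m = q ^ Suc m * phi_partial (inverse q) (Suc m)"
proof -
  have "q ^ Suc m - 1 = q ^ Suc m * (1 - inverse q ^ Suc m)"
    using assms by (simp add: right_diff_distrib power_inverse del: power_Suc)
  thus ?thesis
    by (simp add: phi_partial_def)
qed

text \<open>The polynomial division is never evaluated: the product identity
  \<open>gauss_binomial_mult\<close> is evaluated at \<open>q\<close>, and its denominator, nonzero
  there, is cancelled.\<close>

lemma poly_gauss_binomial:
  assumes q: "norm q > 1" and "k \<le> N"
  shows "poly (gauss_binomial N k) q = q ^ (k * (N - k)) *
           (phi_partial (inverse q) N /
             (phi_partial (inverse q) k * phi_partial (inverse q) (N - k)))"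
proof -
  let ?P = "phi_partial (inverse q)"
  let ?num = "\<lambda>k. \<Prod>i<k. q ^ (N - i) - 1" and ?den = "\<lambda>k. \<Prod>i<k. q ^ Suc i - 1"
  have [simp]: "q \<noteq> 0"
    using q by auto
  have P: "?P n \<noteq> 0" for n
    using q by (intro phi_partial_nonzero) (simp add: norm_inverse inverse_less_1_iff)
  have den: "?den n \<noteq> 0" for n
  proof -
    have "q ^ Suc i - 1 \<noteq> 0" for i
      \<comment> \<open>A vanishing factor would force
        \<open>q ^ Suc i * ?P (Suc i) = 0\<close>.\<close>
      using power_minus_one_mult_phi_partial[of q i] P by auto
    thus ?thesis by simp
  qed
  have "?num k * ?P (N - k) * ?P k = q ^ (k * (N - k)) * ?P N * ?den k"
    using \<open>k \<le> N\<close>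
  proof (induction k)
    case 0
    then show ?case by (simp add: phi_partial_def)
  next
    case (Suc k)
    then obtain d where d: "N - k = Suc d" "N - Suc k = d"
      by (metis Suc_diff_Suc Suc_le_lessD)
    \<comment> \<open>The extra factor \<open>q ^ Suc k\<close> completes \<open>?P (Suc k)\<close>
      to one side of the exchange rule, so that one factor moves from \<open>?P (N - k)\<close> into
      \<open>?num\<close> and another from \<open>?den\<close> into \<open>?P (Suc k)\<close>. It
      cancels at the end, as \<open>k(d+1) + (d+1) = (k+1) + (k+1)d\<close>.\<close>
    have "q ^ Suc k * (?num (Suc k) * ?P d * ?P (Suc k))
        = ?num k * ((q ^ Suc d - 1) * ?P d) * (q ^ Suc k * ?P (Suc k))"
      by (simp add: d mult_ac)
    also have "\<dots> = ?num k * (q ^ Suc d * ?P (Suc d)) * ((q ^ Suc k - 1) * ?P k)"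
      by (simp only: power_minus_one_mult_phi_partial[OF \<open>q \<noteq> 0\<close>])
    also have "\<dots> = (?num k * ?P (N - k) * ?P k) * q ^ Suc d * (q ^ Suc k - 1)"
      by (simp only: d mult_ac)
    also have "\<dots> = q ^ (k * Suc d) * ?P N * ?den k * q ^ Suc d * (q ^ Suc k - 1)"
      using Suc by (simp add: d)
    also have "\<dots> = q ^ Suc k * (q ^ (Suc k * d) * ?P N * ?den (Suc k))"
      by (simp add: power_add mult_ac)
    finally show ?case
      by (simp add: d)
  qed
  moreover have num: "poly (gauss_binomial N k) q * ?den k = ?num k"
    using arg_cong[OF gauss_binomial_mult[of N k], of "\<lambda>f. poly f q"]
    by (simp add: poly_prod poly_monom)
  ultimately have "?den k * (poly (gauss_binomial N k) q * (?P k * ?P (N - k)))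
      = ?den k * (q ^ (k * (N - k)) * ?P N)"
    unfolding num[symmetric] by (simp only: mult_ac)
  hence "poly (gauss_binomial N k) q * (?P k * ?P (N - k)) = q ^ (k * (N - k)) * ?P N"
    using den by simp
  thus ?thesis
    using P by (simp add: field_simps)
qed

section \<open>Normalized Galois numbers and their limits\<close>

lemma norm_inverse_fourth_root:
  fixes q r :: complex
  assumes "norm q > 1" and "r ^ 4 = q"
  shows "norm (inverse r) < 1"
proof -
  have "norm r ^ 4 > 1"
    using assms by (simp flip: norm_power)
  hence "norm r > 1"
    by (metis norm_ge_zero not_le power_le_one)
  thus ?thesis
    by (simp add: norm_inverse inverse_less_1_iff)
qed

lemma normalized_galois_number_eq_sum:
  assumes "norm q > 1" and r: "r ^ 4 = q"
  shows "galois_number N q * r powi (- ((int N)\<^sup>2)) =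
    (\<Sum>k\<le>N. inverse r powi ((int N - 2 * int k)\<^sup>2) *
      (phi_partial (inverse q) N /
        (phi_partial (inverse q) k * phi_partial (inverse q) (N - k))))"
proof -
  have "r \<noteq> 0"
    using assms by auto
  have exponent: "q ^ (k * (N - k)) * r powi (- ((int N)\<^sup>2)) = inverse r powi ((int N - 2 * int k)\<^sup>2)"
    if "k \<le> N" for k
  proof -
    have "q ^ (k * (N - k)) = r powi int (4 * (k * (N - k)))"
      unfolding power_int_of_nat by (simp add: power_mult flip: r)
    moreover have "int (4 * (k * (N - k))) + - ((int N)\<^sup>2) = - ((int N - 2 * int k)\<^sup>2)"
      using that by (simp add: of_nat_diff power2_eq_square algebra_simps)
    ultimately show ?thesis
      using power_int_add[of r "int (4 * (k * (N - k)))" "- ((int N)\<^sup>2)"] \<open>r \<noteq> 0\<close>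
      by (simp only: power_int_minus power_int_inverse) simp
  qed
  show ?thesis
    unfolding galois_number_def galois_poly_def poly_sum sum_distrib_right
    by (intro sum.cong refl)
      (simp only: atMost_iff poly_gauss_binomial[OF assms(1)] exponent[symmetric], simp only: mult_ac)
qed

text \<open>
  The offset \<open>e\<close> treats both parities at once; the summation index \<open>k\<close> becomes \<open>n - j\<close>.
\<close>
lemma normalized_galois_number_tendsto:
  fixes e :: nat
  assumes q: "norm q > 1" and r: "r ^ 4 = q"
  shows "(\<lambda>n. galois_number (2 * n + e) q * r powi (- ((2 * int n + int e)\<^sup>2)))
    \<longlonglongrightarrow> (\<Sum>\<^sub>\<infinity>j::int. inverse r powi ((2 * j + int e)\<^sup>2)) / phi (inverse q)"
proof -
  let ?P = "phi_partial (inverse q)"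
  define t where "t j = inverse r powi ((2 * j + int e)\<^sup>2)" for j :: int
  \<comment> \<open>With \<open>N = 2n + e\<close> and \<open>k = n - j\<close>, one has
    \<open>N - k = n + e + j\<close> and \<open>N - 2k = 2j + e\<close>, and
    \<open>0 \<le> k \<le> N\<close> becomes the window. The value 0 outside it lets every sum range
    over all integers.\<close>
  define c where "c n j = (if j \<in> {- int (n + e)..int n}
     then ?P (2 * n + e) / (?P (nat (int n - j)) * ?P (nat (int n + int e + j))) else 0)"
    for n and j :: int
  have p: "norm (inverse q) < 1"
    using q by (simp add: norm_inverse inverse_less_1_iff)
  have s: "norm (inverse r) < 1"
    by (rule norm_inverse_fourth_root[OF q r])
  have lim: "?P \<longlonglongrightarrow> phi (inverse q)"
    by (rule phi_partial_tendsto[OF p])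
  then obtain B where B: "\<And>n. norm (?P n) \<le> B"
    by (meson BseqE convergentI convergent_imp_Bseq)
  \<comment> \<open>As \<open>phi (inverse q)\<close> is nonzero, the reciprocals converge too.
    Hence both sequences are bounded, and \<open>c\<close> is bounded uniformly in \<open>n\<close>
    and \<open>j\<close>.\<close>
  have "(\<lambda>n. inverse (?P n)) \<longlonglongrightarrow> inverse (phi (inverse q))"
    by (rule tendsto_inverse[OF lim phi_nonzero[OF p]])
  then obtain D where D: "\<And>n. norm (inverse (?P n)) \<le> D"
    by (meson BseqE convergentI convergent_imp_Bseq)
  have "0 \<le> B" "0 \<le> D"
    using B[of 0] D[of 0] norm_ge_zero order_trans by blast+
  have c_le: "norm (c n j) \<le> B * (D * D)" for n j
  proof -
    have "norm (?P a * (inverse (?P b) * inverse (?P d))) \<le> B * (D * D)" for a b d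
      unfolding norm_mult using \<open>0 \<le> B\<close> \<open>0 \<le> D\<close> B D by (intro mult_mono) auto
    thus ?thesis
      using \<open>0 \<le> B\<close> \<open>0 \<le> D\<close> by (simp add: c_def divide_inverse)
  qed
  have c_lim: "(\<lambda>n. c n j) \<longlonglongrightarrow> inverse (phi (inverse q))" for j
  proof -
    have a: "filterlim (\<lambda>n. 2 * n + e) at_top sequentially"
      by (rule filterlim_at_top_mono[OF filterlim_ident]) auto
    have b: "filterlim (\<lambda>n. nat (int n + i)) at_top sequentially" for i
      unfolding filterlim_at_top
    proof
      fix Z
      show "\<forall>\<^sub>F n in sequentially. Z \<le> nat (int n + i)"
        using eventually_ge_at_top[of "Z + nat (- i)"] by eventually_elim linarith
    qed
    have "(\<lambda>n. ?P (2 * n + e) / (?P (nat (int n + (- j))) * ?P (nat (int n + (int e + j)))))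
        \<longlonglongrightarrow> phi (inverse q) / (phi (inverse q) * phi (inverse q))"
      using phi_nonzero[OF p]
      by (intro tendsto_divide tendsto_mult filterlim_compose[OF lim] a b) auto
    moreover have "\<forall>\<^sub>F n in sequentially.
        ?P (2 * n + e) / (?P (nat (int n + (- j))) * ?P (nat (int n + (int e + j)))) = c n j"
      \<comment> \<open>Once \<open>n \<ge> \<bar>j\<bar>\<close>, the index \<open>j\<close> lies
        in the window.\<close>
      using eventually_ge_at_top[of "nat \<bar>j\<bar>"]
      by eventually_elim (auto simp: c_def add.assoc)
    ultimately have "(\<lambda>n. c n j) \<longlonglongrightarrow> phi (inverse q) / (phi (inverse q) * phi (inverse q))"
      by (rule Lim_transform_eventually)
    thus ?thesis
      using phi_nonzero[OF p] by (simp add: field_simps)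
  qed
  have "t summable_on UNIV"
  proof -
    let ?f = "\<lambda>k::int. inverse r powi (k\<^sup>2)" and ?h = "\<lambda>j::int. 2 * j + int e"
    have "?f summable_on range ?h"
      using theta_terms_summable[OF s, of 1] by (auto intro: summable_on_subset_banach[of ?f UNIV])
    hence "(?f \<circ> ?h) summable_on UNIV"
      by (subst (asm) summable_on_reindex) (auto simp: inj_def)
    thus ?thesis by (simp add: t_def[abs_def] o_def)
  qed
  hence "(\<lambda>j. norm (t j)) summable_on UNIV"
    by (simp add: summable_on_iff_abs_summable_on_complex)
  \<comment> \<open>This is the dominating function: it does not depend on \<open>n\<close>.\<close>
  hence "(\<lambda>j. norm (t j) * (B * (D * D))) summable_on UNIV"
    by (rule summable_on_cmult_left)
  hence "(\<lambda>n. \<Sum>\<^sub>\<infinity>j. t j * c n j) \<longlonglongrightarrow> (\<Sum>\<^sub>\<infinity>j. t j * inverse (phi (inverse q)))"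
    by (rule infsum_dominated_convergence)
      (auto simp: norm_mult intro!: mult_left_mono c_le tendsto_mult c_lim)
  moreover have "(\<Sum>\<^sub>\<infinity>j. t j * c n j)
      = galois_number (2 * n + e) q * r powi (- ((2 * int n + int e)\<^sup>2))" for n
  proof -
    have "(\<Sum>\<^sub>\<infinity>j. t j * c n j) = (\<Sum>\<^sub>\<infinity>j\<in>{- int (n + e)..int n}. t j * c n j)"
      by (rule infsum_cong_neutral) (auto simp: c_def)
    also have "\<dots> = (\<Sum>j\<in>{- int (n + e)..int n}. t j * c n j)"
      by simp
    also have "\<dots> = (\<Sum>k\<le>2 * n + e. inverse r powi ((int (2 * n + e) - 2 * int k)\<^sup>2) *
      (?P (2 * n + e) / (?P k * ?P (2 * n + e - k))))"
    proof (rule sum.reindex_bij_witness[of _ "\<lambda>k. int n - int k" "\<lambda>j. nat (int n - j)"])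
      fix j assume j: "j \<in> {- int (n + e)..int n}"
      define k where "k = nat (int n - j)"
      have k: "j = int n - int k" "nat (int n + int e + j) = 2 * n + e - k"
        using j by (auto simp: k_def)
      have m: "int (2 * n + e) - 2 * int k = 2 * j + int e"
        using k(1) by simp
      show "inverse r powi ((int (2 * n + e) - 2 * int (nat (int n - j)))\<^sup>2) *
          (?P (2 * n + e) / (?P (nat (int n - j)) * ?P (2 * n + e - nat (int n - j)))) =
          t j * c n j"
        unfolding t_def c_def k_def[symmetric] m k(2) using j by simp
    qed auto
    also have "\<dots> = galois_number (2 * n + e) q * r powi (- ((int (2 * n + e))\<^sup>2))"
      by (rule normalized_galois_number_eq_sum[OF q r, symmetric])
    finally show ?thesis by simp
  qed
  ultimately show ?thesis
    by (simp add: infsum_cmult_left' t_def divide_inverse)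
qed

section \<open>Splitting the alternating theta series by parity\<close>

lemma theta4_eq_diff:
  assumes "norm s < 1"
  shows "theta4 0 s = theta3 0 (s ^ 4) - theta2 0 s"
proof -
  let ?f = "\<lambda>k::int. (-1) powi k * s powi (k\<^sup>2)"
  let ?ev = "\<lambda>k::int. 2 * k" and ?od = "\<lambda>k::int. 2 * k + 1"
  have inj: "inj ?ev" "inj ?od"
    by (auto simp: inj_def)
  have "?f summable_on UNIV"
    using theta4_summable[OF assms, of 0] by simp
  hence sub: "?f summable_on A" for A
    by (rule summable_on_subset_banach) auto
  have ev: "range ?ev = {k. even k}"
    by (auto elim: evenE)
  have od: "range ?od = {k. odd k}"
    by (auto elim: oddE)
  have un: "UNIV = range ?ev \<union> range ?od" and disj: "range ?ev \<inter> range ?od = {}"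
    unfolding ev od by blast+
  \<comment> \<open>Even indices \<open>2k\<close> carry the sign \<open>+\<close> and the power
    \<open>s^(4k^2)\<close>, a term of \<open>theta3\<close> with nome \<open>s^4\<close>. Odd
    indices carry the sign \<open>-\<close> and give \<open>theta2\<close>, whose second argument is
    already the fourth root of the nome.\<close>
  have "infsum ?f UNIV = infsum ?f (range ?ev) + infsum ?f (range ?od)"
    by (rule infsum_Un_disjoint[OF sub sub disj, folded un])
  also have "infsum ?f (range ?ev) = theta3 0 (s ^ 4)"
  proof -
    have "?f (2 * k) = (s ^ 4) powi (k\<^sup>2)" for k
      using power_int_mult[of s 4 "k\<^sup>2"] by (simp add: power_mult_distrib)
    thus ?thesis
      unfolding infsum_reindex[OF inj(1)] o_def theta3_def by simp
  qed
  also have "infsum ?f (range ?od) = - theta2 0 s"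
  proof -
    have "?f (2 * k + 1) = - (s powi ((2 * k + 1)\<^sup>2))" for k
      by (simp add: power_int_minus_left)
    thus ?thesis
      unfolding infsum_reindex[OF inj(2)] o_def theta2_def by (simp add: infsum_uminus)
  qed
  finally show ?thesis
    by (simp add: theta4_def)
qed

theorem corollary3p6:
  fixes q r :: complex
  assumes "norm q > 1" and "r ^ 4 = q"
  shows "(\<lambda>n. galois_number (2 * n + 1) q * r powi (- ((2 * int n + 1)\<^sup>2)))
           \<longlonglongrightarrow> galois_limit_odd q r \<and>
         galois_limit_odd q r = theta2 0 (inverse r) / phi (inverse q) \<and>
         (\<lambda>n. galois_number (2 * n) q * r powi (- ((2 * int n)\<^sup>2)))
           \<longlonglongrightarrow> galois_limit_even q r \<and>
         galois_limit_even q r = theta3 0 (inverse q) / phi (inverse q) \<and>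
         galois_limit_even q r - galois_limit_odd q r = theta4 0 (inverse r) / phi (inverse q)"
proof -
  have s: "norm (inverse r) < 1"
    by (rule norm_inverse_fourth_root[OF assms])
  have s4: "inverse r ^ 4 = inverse q"
    using assms by (simp add: power_inverse)
  have odd: "(\<lambda>n. galois_number (2 * n + 1) q * r powi (- ((2 * int n + 1)\<^sup>2)))
      \<longlonglongrightarrow> theta2 0 (inverse r) / phi (inverse q)"
    using normalized_galois_number_tendsto[OF assms, of 1] by (simp add: theta2_def)
  \<comment> \<open>For offset 0 all exponents are multiples of 4, so only \<open>q\<close> itself
    enters and the choice of root disappears.\<close>
  have "inverse r powi ((2 * k)\<^sup>2) = inverse q powi (k\<^sup>2)" for k :: int
    unfolding s4[symmetric]
    using power_int_mult[of "inverse r" 4 "k\<^sup>2"] by (simp add: power_mult_distrib)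
  hence even: "(\<lambda>n. galois_number (2 * n) q * r powi (- ((2 * int n)\<^sup>2)))
      \<longlonglongrightarrow> theta3 0 (inverse q) / phi (inverse q)"
    using normalized_galois_number_tendsto[OF assms, of 0] by (simp add: theta3_def)
  have "galois_limit_odd q r = theta2 0 (inverse r) / phi (inverse q)"
    unfolding galois_limit_odd_def by (rule limI[OF odd])
  moreover have "galois_limit_even q r = theta3 0 (inverse q) / phi (inverse q)"
    unfolding galois_limit_even_def by (rule limI[OF even])
  ultimately show ?thesis
    using odd even theta4_eq_diff[OF s] by (simp add: s4 diff_divide_distrib)
qed

end
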